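(* Let $\xi$ be a standard normal random variable and $\{\xi_{n,k}\}$ a standard triangular array, and let $h : \mathbb{R} \rightarrow \mathbb{R}$ be any continuously differentiable map with a bounded derivative. Then the Stein transform $f_h$ of $h$ is twice continuously differentiable, has bounded first and second derivatives, and the inequality $$\left|\mathbb{E}\left[h(\xi) - h\left(\sum_{k=1}^n \xi_{n,k}\right)\right]\right| \leq \frac{1}{2}\|f_h''\|_\infty\, \epsilon + \left(\sup_{x_1,x_2 \in \mathbb{R}} \left|f_h'(x_1) - f_h'(x_2)\right|\right) \sum_{k=1}^n \mathbb{E}\left[\xi_{n,k}^2 ; \left|\xi_{n,k}\right| \geq \epsilon\right] + \left(\sup_{x_1,x_2 \in \mathbb{R}} \left|f_h''(x_1) - f_h''(x_2)\right|\right) \max_{1 \leq k \leq n} \mathbb{E}\left[\left|\xi_{n,k}\right|\right]$$ holds for all $n$ and all $\epsilon > 0$.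
   Context: All random variables are real-valued and defined on a fixed probability space $(\Omega,\mathcal{F},\mathbb{P})$. A standard triangular array (STA) is a family $\{\xi_{n,k}\}_{n \geq 1,\, 1 \leq k \leq n}$ of random variables such that $\xi_{n,1},\ldots,\xi_{n,n}$ are independent for all $n$, $\mathbb{E}[\xi_{n,k}] = 0$ for all $n,k$, and $\sum_{k=1}^n \mathbb{E}[\xi_{n,k}^2] = 1$ for all $n$. For a random variable $X$ and an event $A$, $\mathbb{E}[X ; A]$ denotes $\mathbb{E}[X \mathbf{1}_A]$. For a continuous map $h : \mathbb{R} \rightarrow \mathbb{R}$ with $\mathbb{E}|h(\xi)| < \infty$, the Stein transform of $h$ is the map $f_h : \mathbb{R} \rightarrow \mathbb{R}$ defined by $$f_h(x) = e^{x^2/2} \int_{-\infty}^x \left(h(t) - \mathbb{E}[h(\xi)]\right) e^{-t^2/2}\, dt.$$ $\|\cdot\|_\infty$ denotes the supremum norm on $\mathbb{R}$. *)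

theory Defs
  imports "HOL-Probability.Probability"
begin

context prob_space
begin

text \<open>Only the entries \<^term>\<open>X n k\<close> with \<^term>\<open>1 \<le> k \<and> k \<le> n\<close> matter.  The Bochner integral of a
  non-integrable function is \<^term>\<open>0::real\<close>, so the finiteness of the first two moments, which the
  prescribed values of the moments presuppose, is demanded explicitly.\<close>

definition standard_triangular_array :: "(nat \<Rightarrow> nat \<Rightarrow> 'a \<Rightarrow> real) \<Rightarrow> bool" where
  "standard_triangular_array X \<longleftrightarrow> (\<forall>n\<ge>1.
     indep_vars (\<lambda>_. borel) (X n) {1..n} \<and>
     (\<forall>k\<in>{1..n}. integrable M (X n k) \<and> expectation (X n k) = 0) \<and>
     (\<forall>k\<in>{1..n}. integrable M (\<lambda>\<omega>. (X n k \<omega>)\<^sup>2)) \<and>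
     (\<Sum>k=1..n. expectation (\<lambda>\<omega>. (X n k \<omega>)\<^sup>2)) = 1)"

definition stein_transform :: "('a \<Rightarrow> real) \<Rightarrow> (real \<Rightarrow> real) \<Rightarrow> real \<Rightarrow> real" where
  "stein_transform \<xi> h x =
     exp (x\<^sup>2 / 2) *
     (LBINT t:{..x}. (h t - expectation (\<lambda>\<omega>. h (\<xi> \<omega>))) * exp (- t\<^sup>2 / 2))"

end

text \<open>Both suprema are taken in \<^typ>\<open>real\<close>, so they are meaningful only for bounded functions.\<close>

definition sup_norm :: "(real \<Rightarrow> real) \<Rightarrow> real" where
  "sup_norm g = (SUP x. \<bar>g x\<bar>)"

definition oscillation :: "(real \<Rightarrow> real) \<Rightarrow> real" where
  "oscillation g = (SUP (x\<^sub>1, x\<^sub>2). \<bar>g x\<^sub>1 - g x\<^sub>2\<bar>)"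

end

theory Submission
  imports Defs
begin

text \<open>
  Let \<open>c\<close> be the mean of \<open>h\<close> under the standard normal law. The transform \<open>f\<close> solves Stein's equation
  \<open>f' = x f + (h - c)\<close>, and differentiating shows that \<open>F = f'\<close> solves \<open>F' = x F + (f + h')\<close>.
  With the weight \<open>w x = exp (- x\<^sup>2 / 2)\<close>, any solution of \<open>F' = x F + q\<close> satisfies \<open>(F w)' = q w\<close>, so that
  \<open>F w\<close> can be compared with \<open>V w\<close> for an explicit \<open>V\<close> whenever both vanish at infinity. A constant \<open>V\<close>
  bounds \<open>f\<close>; then \<open>V = K / x\<close> bounds \<open>x f'\<close>, and hence \<open>f''\<close>.

  For the inequality, Stein's equation turns the left-hand side into \<open>E[W f(W)] - E[f'(W)]\<close>, where \<open>W\<close>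
  is the sum of the row. Each \<open>E[X\<^sub>k f(W)]\<close> is expanded around \<open>W - X\<^sub>k\<close>, which is independent of
  \<open>X\<^sub>k\<close>; the Taylor remainder is bounded through \<open>f''\<close> if \<open>\<bar>X\<^sub>k\<bar> < \<epsilon>\<close> and through the oscillation of
  \<open>f'\<close> otherwise. Replacing \<open>f'(W - X\<^sub>k)\<close> by \<open>f'(W)\<close> costs at most the supremum of \<open>\<bar>f''\<bar>\<close> times
  \<open>E\<bar>X\<^sub>k\<bar>\<close>, and that supremum is at most the oscillation of \<open>f''\<close>.
\<close>

section \<open>Primitives of integrable functions over half-lines\<close>

text \<open>The transform is \<open>exp (x\<^sup>2 / 2)\<close> times such a primitive. The
  derivative yields Stein's equation; the two limits supply the vanishing conditions at infinity
  that the comparison argument requires.\<close>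

lemma lborel_atMost_integral:
  fixes p :: "real \<Rightarrow> real"
  assumes cont: "continuous_on UNIV p" and int: "integrable lborel p"
  shows "((\<lambda>x. LBINT t:{..x}. p t) has_real_derivative p x) (at x)"
    and "((\<lambda>x. LBINT t:{..x}. p t) \<longlongrightarrow> 0) at_bot"
    and "((\<lambda>x. LBINT t:{..x}. p t) \<longlongrightarrow> integral\<^sup>L lborel p) at_top"
proof -
  have [measurable]: "p \<in> borel_measurable borel"
    using cont by (rule borel_measurable_continuous_onI)
  let ?P = "\<lambda>x. LBINT t:{..x}. p t"
  have si: "set_integrable lborel A p" if "A \<in> sets borel" for A
    unfolding set_integrable_def using int that by (intro integrable_mult_indicator) auto
  have split: "?P u = ?P a + (LBINT t:{a..u}. p t)" if "a \<le> u" for a u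
  proof -
    have "?P u = (LBINT t:{..<a} \<union> {a..u}. p t)"
      using that by (intro arg_cong[where f = "\<lambda>A. LBINT t:A. p t"]) auto
    also have "\<dots> = (LBINT t:{..<a}. p t) + (LBINT t:{a..u}. p t)"
      by (intro set_integral_Un si) auto
    also have "(LBINT t:{..<a}. p t) = ?P a"
      unfolding set_lebesgue_integral_def
    proof (rule integral_cong_AE)
      show "AE t in lborel. indicator {..<a} t *\<^sub>R p t = indicator {..a} t *\<^sub>R p t"
        using AE_lborel_singleton[of a] by eventually_elim (auto simp: indicator_def)
    qed auto
    finally show ?thesis .
  qed
  have cont': "continuous_on A p" for A
    using cont by (rule continuous_on_subset) auto
  \<comment> \<open>The fundamental theorem of calculus is applied on a compact interval with
    \<open>x\<close> in its interior, so the derivative within the interval is a full one. The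
    constant \<open>?P (x - 1)\<close> restores the part of the half-line to the left.\<close>
  have "((\<lambda>u. ?P (x - 1) + integral {x - 1..u} p) has_real_derivative p x) (at x within {x - 1..x + 1})"
    by (rule derivative_eq_intros integral_has_real_derivative cont' refl | simp)+
  then have "((\<lambda>u. ?P (x - 1) + integral {x - 1..u} p) has_real_derivative p x) (at x)"
    by (simp add: at_within_Icc_at)
  then show "(?P has_real_derivative p x) (at x)"
  proof (rule DERIV_cong_ev[THEN iffD1, rotated -1])
    show "\<forall>\<^sub>F u in nhds x. ?P (x - 1) + integral {x - 1..u} p = ?P u"
      using eventually_nhds_in_open[of "{x - 1<..<x + 1}" x]
    proof (rule eventually_mono[rotated 2])
      fix u assume "u \<in> {x - 1<..<x + 1}"
      then show "?P (x - 1) + integral {x - 1..u} p = ?P u"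
        using split[of "x - 1" u] set_borel_integral_eq_integral(2)[OF si, of "{x - 1..u}"] by simp
    qed auto
  qed auto
  \<comment> \<open>For \<open>x \<le> 0\<close> the primitive is \<open>?P 0\<close> minus the
    integral over \<open>{x..0}\<close>, and these integrals exhaust \<open>?P 0\<close>.\<close>
  have "((\<lambda>x. ?P 0 - (LBINT t:{x..0}. p t)) \<longlongrightarrow> ?P 0 - ?P 0) at_bot"
    by (intro tendsto_intros tendsto_set_lebesgue_integral_at_bot si) auto
  moreover have "\<forall>\<^sub>F x in at_bot. ?P 0 - (LBINT t:{x..0}. p t) = ?P x"
    using eventually_le_at_bot[of 0] by eventually_elim (use split in \<open>smt (verit)\<close>)
  ultimately show "(?P \<longlongrightarrow> 0) at_bot"
    by (auto elim!: Lim_transform_eventually)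
  show "(?P \<longlongrightarrow> integral\<^sup>L lborel p) at_top"
    using tendsto_integral_at_top[OF _ int] by (simp add: set_lebesgue_integral_def)
qed

section \<open>Growth of solutions of \<open>F' = x F + q\<close>\<close>

lemma affine_times_gaussian_tendsto_0:
  "((\<lambda>x::real. (a + b * \<bar>x\<bar>) * exp (- x\<^sup>2 / 2)) \<longlongrightarrow> 0) at_top"
  "((\<lambda>x::real. (a + b * \<bar>x\<bar>) * exp (- x\<^sup>2 / 2)) \<longlongrightarrow> 0) at_bot"
  by real_asymp+

text \<open>With \<open>w x = exp (- x\<^sup>2 / 2)\<close>, the hypotheses say that \<open>(V \<plusminus> F) w\<close> decreases to \<open>0\<close>.\<close>

lemma stein_equation_comparison:
  fixes F V :: "real \<Rightarrow> real"
  assumes F': "\<And>x. x \<ge> a \<Longrightarrow> (F has_real_derivative x * F x + q x) (at x)"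
    and V': "\<And>x. x \<ge> a \<Longrightarrow> (V has_real_derivative V' x) (at x)"
    and le: "\<And>x. x \<ge> a \<Longrightarrow> \<bar>q x\<bar> \<le> x * V x - V' x"
    and F0: "((\<lambda>x. F x * exp (- x\<^sup>2 / 2)) \<longlongrightarrow> 0) at_top"
    and V0: "((\<lambda>x. V x * exp (- x\<^sup>2 / 2)) \<longlongrightarrow> 0) at_top"
    and "x \<ge> a"
  shows "\<bar>F x\<bar> \<le> V x"
proof -
  \<comment> \<open>The sign \<open>s\<close> handles \<open>F\<close> and \<open>- F\<close> in one
    argument.\<close>
  have "s * F x \<le> V x" if s: "\<bar>s\<bar> = 1" for s :: real
  proof -
    define D where "D = (\<lambda>x. V x * exp (- x\<^sup>2 / 2) - s * (F x * exp (- x\<^sup>2 / 2)))"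
    have D': "(D has_real_derivative (V' x - x * V x - s * q x) * exp (- x\<^sup>2 / 2)) (at x)" if "x \<ge> a" for x
      unfolding D_def
      by (rule derivative_eq_intros F' V' that refl | simp)+ (simp add: algebra_simps)
    have "D y \<le> D x" if "x \<le> y" for y
    proof (rule DERIV_nonpos_imp_nonincreasing[OF that])
      fix z assume "x \<le> z" "z \<le> y"
      then have "z \<ge> a" using \<open>x \<ge> a\<close> by simp
      have "V' z - z * V z - s * q z \<le> 0"
        using le[OF \<open>z \<ge> a\<close>] s by (auto simp: abs_if split: if_splits)
      then show "\<exists>y. (D has_real_derivative y) (at z) \<and> y \<le> 0"
        using D'[OF \<open>z \<ge> a\<close>] by (auto intro!: exI mult_nonpos_nonneg)
    qed
    moreover have "(D \<longlongrightarrow> 0 - s * 0) at_top"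
      unfolding D_def by (intro tendsto_intros F0 V0)
    ultimately have "D x \<ge> 0"
      by (intro tendsto_upperbound[where f = D and F = at_top])
         (auto intro: eventually_at_top_linorderI[of x])
    then have "0 \<le> (V x - s * F x) * exp (- x\<^sup>2 / 2)"
      by (simp add: D_def algebra_simps)
    then show ?thesis
      by (simp add: zero_le_mult_iff)
  qed
  from this[of 1] this[of "-1"] show ?thesis by simp
qed

text \<open>If \<open>F\<close> solves the equation for \<open>q\<close>, then
  \<open>\<lambda>x. - F (- x)\<close> solves it for \<open>\<lambda>x. q (- x)\<close>. The
  negative half-line thus reduces to the one-sided comparison.\<close>

lemma stein_equation_comparison_two_sided:
  fixes F V :: "real \<Rightarrow> real"
  assumes F': "\<And>x. (F has_real_derivative x * F x + q x) (at x)"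
    and V': "\<And>x. x \<ge> a \<Longrightarrow> (V has_real_derivative V' x) (at x)"
    and le: "\<And>x. \<bar>x\<bar> \<ge> a \<Longrightarrow> \<bar>q x\<bar> \<le> \<bar>x\<bar> * V \<bar>x\<bar> - V' \<bar>x\<bar>"
    and F0: "((\<lambda>x. F x * exp (- x\<^sup>2 / 2)) \<longlongrightarrow> 0) at_top"
            "((\<lambda>x. F x * exp (- x\<^sup>2 / 2)) \<longlongrightarrow> 0) at_bot"
    and V0: "((\<lambda>x. V x * exp (- x\<^sup>2 / 2)) \<longlongrightarrow> 0) at_top"
    and a: "a \<ge> 0" and x: "\<bar>x\<bar> \<ge> a"
  shows "\<bar>F x\<bar> \<le> V \<bar>x\<bar>"
proof (cases "x \<ge> 0")
  case True
  have le': "\<bar>q y\<bar> \<le> y * V y - V' y" if "y \<ge> a" for y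
    using le[of y] a that by simp
  have "\<bar>F x\<bar> \<le> V x"
    by (rule stein_equation_comparison[where a = a and q = q and V = V and V' = V' and F = F])
       (use F' V' F0(1) V0 True x le' in simp_all)
  with True show ?thesis by simp
next
  case False
  have le': "\<bar>q (- y)\<bar> \<le> y * V y - V' y" if "y \<ge> a" for y
    using le[of "- y"] a that by simp
  have "((\<lambda>x. - F (- x)) has_real_derivative y * - F (- y) + q (- y)) (at y)" for y
    using DERIV_chain2[where f = F and g = uminus and x = y, OF F' DERIV_minus[OF DERIV_ident]]
    by (auto intro!: derivative_eq_intros)
  moreover have "((\<lambda>x. - F (- x) * exp (- x\<^sup>2 / 2)) \<longlongrightarrow> 0) at_top"
    using tendsto_minus[OF F0(2)] by (simp add: at_bot_mirror filterlim_filtermap)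
  ultimately have "\<bar>- F (- (- x))\<bar> \<le> V (- x)"
    by (intro stein_equation_comparison[where a = a and q = "\<lambda>x. q (- x)" and V' = V' and F = "\<lambda>x. - F (- x)"])
       (use V' le' V0 False x in simp_all)
  with False show ?thesis by simp
qed

text \<open>For \<open>\<bar>x\<bar> \<ge> 1\<close> the constant
  \<open>K = \<bar>A\<bar> + \<bar>B\<bar>\<close> is an admissible comparison function, because
  \<open>A + B * \<bar>x\<bar> \<le> K * \<bar>x\<bar>\<close> there. On \<open>{-1..1}\<close>
  continuity and compactness suffice.\<close>

lemma stein_equation_bounded:
  fixes F :: "real \<Rightarrow> real"
  assumes F': "\<And>x. (F has_real_derivative x * F x + q x) (at x)"
    and q: "\<And>x. \<bar>q x\<bar> \<le> A + B * \<bar>x\<bar>"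
    and F0: "((\<lambda>x. F x * exp (- x\<^sup>2 / 2)) \<longlongrightarrow> 0) at_top"
            "((\<lambda>x. F x * exp (- x\<^sup>2 / 2)) \<longlongrightarrow> 0) at_bot"
  obtains K where "\<And>x. \<bar>F x\<bar> \<le> K"
proof -
  have "continuous_on {-1..1} F"
    using F' by (meson DERIV_isCont continuous_at_imp_continuous_on)
  then have "bounded (F ` {-1..1})"
    by (intro compact_imp_bounded compact_continuous_image) auto
  then obtain C where C: "\<And>x. x \<in> {-1..1} \<Longrightarrow> \<bar>F x\<bar> \<le> C"
    unfolding bounded_iff by (metis image_eqI real_norm_def)
  define K where "K = \<bar>A\<bar> + \<bar>B\<bar>"
  have K: "\<bar>F x\<bar> \<le> K" if "\<bar>x\<bar> \<ge> 1" for x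
  proof (rule stein_equation_comparison_two_sided[where a = 1 and V' = "\<lambda>_. 0" and V = "\<lambda>_. K", OF F'])
    fix x :: real assume "1 \<le> \<bar>x\<bar>"
    have "A + B * \<bar>x\<bar> \<le> \<bar>A\<bar> * \<bar>x\<bar> + \<bar>B\<bar> * \<bar>x\<bar>"
      using \<open>1 \<le> \<bar>x\<bar>\<close>
      by (intro add_mono mult_right_mono) (auto intro: order.trans[OF abs_ge_self] simp: mult_le_cancel_left1)
    then show "\<bar>q x\<bar> \<le> \<bar>x\<bar> * K - 0"
      using q[of x] by (simp add: K_def algebra_simps)
  next
    show "((\<lambda>x. K * exp (- x\<^sup>2 / 2)) \<longlongrightarrow> 0) at_top"
      by real_asymp
  qed (use F0 that in auto)
  have "\<bar>F x\<bar> \<le> max C K" for x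
  proof (cases "\<bar>x\<bar> \<ge> 1")
    case True
    from K[OF this] show ?thesis by simp
  next
    case False
    then have "x \<in> {-1..1}" by auto
    from C[OF this] show ?thesis by simp
  qed
  then show ?thesis using that by blast
qed

text \<open>For \<open>V = B / x\<close> the expression \<open>x V - V'\<close> equals
  \<open>B + B / x\<^sup>2\<close>, which dominates \<open>q\<close>. Hence
  \<open>\<bar>F x\<bar> \<le> B / \<bar>x\<bar>\<close> away from the origin; near it,
  \<open>\<bar>x * F x\<bar> \<le> \<bar>F x\<bar>\<close>.\<close>

lemma stein_equation_decay:
  fixes F :: "real \<Rightarrow> real"
  assumes F': "\<And>x. (F has_real_derivative x * F x + q x) (at x)"
    and q: "\<And>x. \<bar>q x\<bar> \<le> B"
    and F0: "((\<lambda>x. F x * exp (- x\<^sup>2 / 2)) \<longlongrightarrow> 0) at_top"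
            "((\<lambda>x. F x * exp (- x\<^sup>2 / 2)) \<longlongrightarrow> 0) at_bot"
  obtains K where "\<And>x. \<bar>F x\<bar> \<le> K" "\<And>x. \<bar>x * F x\<bar> \<le> K"
proof -
  have "\<bar>q x\<bar> \<le> B + 0 * \<bar>x\<bar>" for x using q by simp
  from stein_equation_bounded[OF F' this F0] obtain C where C: "\<And>x. \<bar>F x\<bar> \<le> C" by blast
  have "B \<ge> 0" using q[of 0] by simp
  have V': "((\<lambda>x. B / x) has_real_derivative - B / x\<^sup>2) (at x)" if "1 \<le> x" for x
    using that by (auto intro!: derivative_eq_intros simp: power2_eq_square)
  have dec: "\<bar>F x\<bar> \<le> B / \<bar>x\<bar>" if "\<bar>x\<bar> \<ge> 1" for x
  proof (rule stein_equation_comparison_two_sided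
      [where a = 1 and V' = "\<lambda>x. - B / x\<^sup>2" and V = "\<lambda>x. B / x", OF F'])
    fix x :: real assume x: "1 \<le> \<bar>x\<bar>"
    show "\<bar>q x\<bar> \<le> \<bar>x\<bar> * (B / \<bar>x\<bar>) - - B / \<bar>x\<bar>\<^sup>2"
      using x q[of x] \<open>B \<ge> 0\<close> by (auto intro!: add_increasing2)
  next
    show "((\<lambda>x. B / x * exp (- x\<^sup>2 / 2)) \<longlongrightarrow> 0) at_top"
      by real_asymp
  qed (use F0 V' that in simp_all)
  have "\<bar>x * F x\<bar> \<le> max B C" for x
  proof (cases "\<bar>x\<bar> \<ge> 1")
    case True
    have "\<bar>F x\<bar> * \<bar>x\<bar> \<le> B"
      using dec[OF True] True by (simp add: pos_le_divide_eq)
    then show ?thesis by (simp add: abs_mult mult.commute)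
  next
    case False
    then have "\<bar>x\<bar> * \<bar>F x\<bar> \<le> 1 * \<bar>F x\<bar>" by (intro mult_right_mono) auto
    then show ?thesis using C[of x] by (simp add: abs_mult)
  qed
  moreover have "\<bar>F x\<bar> \<le> max B C" for x using C[of x] by simp
  ultimately show ?thesis using that by blast
qed

text \<open>The derivative \<open>f1\<close> solves an equation of the same type with inhomogeneity
  \<open>f + g'\<close>. This is bounded once \<open>f\<close> is, so the decay estimate controls
  \<open>x * f1 x\<close> and with it \<open>f2\<close>.\<close>

lemma stein_equation_C2_solution:
  fixes f g g' :: "real \<Rightarrow> real"
  assumes f': "\<And>x. (f has_real_derivative x * f x + g x) (at x)"
    and g': "\<And>x. (g has_real_derivative g' x) (at x)"
    and cont: "continuous_on UNIV g'"
    and L: "\<And>x. \<bar>g' x\<bar> \<le> L"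
    and f0: "((\<lambda>x. f x * exp (- x\<^sup>2 / 2)) \<longlongrightarrow> 0) at_top"
            "((\<lambda>x. f x * exp (- x\<^sup>2 / 2)) \<longlongrightarrow> 0) at_bot"
  obtains f2 where "\<And>x. ((\<lambda>x. x * f x + g x) has_real_derivative f2 x) (at x)"
    "continuous_on UNIV f2" "bounded (range (\<lambda>x. x * f x + g x))" "bounded (range f2)"
proof -
  define f1 where "f1 = (\<lambda>x. x * f x + g x)"
  define f2 where "f2 = (\<lambda>x. x * f1 x + (f x + g' x))"
  have f1: "(f1 has_real_derivative f2 x) (at x)" for x
    unfolding f1_def f2_def by (auto intro!: derivative_eq_intros f' g')
  have g: "\<bar>g x\<bar> \<le> \<bar>g 0\<bar> + L * \<bar>x\<bar>" for x
  proof -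
    have "norm (g x - g 0) \<le> L * norm (x - 0)"
      using L by (intro field_differentiable_bound[of UNIV g g' L])
        (auto intro: has_field_derivative_at_within g')
    then show ?thesis by simp
  qed
  obtain K where K: "\<And>x. \<bar>f x\<bar> \<le> K"
    using stein_equation_bounded[OF f' g f0] by blast
  \<comment> \<open>Linear growth of \<open>f1\<close> is all that its own vanishing condition at
    infinity needs, since the Gaussian weight beats it.\<close>
  have "\<bar>f1 x\<bar> \<le> \<bar>g 0\<bar> + (K + L) * \<bar>x\<bar>" for x
  proof -
    have "\<bar>f1 x\<bar> \<le> \<bar>x\<bar> * \<bar>f x\<bar> + \<bar>g x\<bar>"
      unfolding f1_def by (metis abs_mult abs_triangle_ineq)
    also have "\<dots> \<le> \<bar>x\<bar> * K + (\<bar>g 0\<bar> + L * \<bar>x\<bar>)"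
      by (intro add_mono mult_left_mono K g) auto
    finally show ?thesis by (simp add: algebra_simps)
  qed
  then have le: "norm (f1 x * exp (- x\<^sup>2 / 2)) \<le> (\<bar>g 0\<bar> + (K + L) * \<bar>x\<bar>) * exp (- x\<^sup>2 / 2)" for x
    by (simp add: abs_mult)
  have "((\<lambda>x. f1 x * exp (- x\<^sup>2 / 2)) \<longlongrightarrow> 0) at_top" "((\<lambda>x. f1 x * exp (- x\<^sup>2 / 2)) \<longlongrightarrow> 0) at_bot"
    by (rule Lim_null_comparison[OF always_eventually affine_times_gaussian_tendsto_0(1)] allI le
             Lim_null_comparison[OF always_eventually affine_times_gaussian_tendsto_0(2)])+
  moreover have q: "\<bar>f x + g' x\<bar> \<le> K + L" for x
    using K[of x] L[of x] by linarith
  ultimately obtain C where C: "\<And>x. \<bar>f1 x\<bar> \<le> C" "\<And>x. \<bar>x * f1 x\<bar> \<le> C"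
    using stein_equation_decay[OF f1[unfolded f2_def]] by blast
  have "\<bar>f2 x\<bar> \<le> C + (K + L)" for x
    unfolding f2_def using C(2)[of x] q[of x] by linarith
  then have "bounded (range f1)" "bounded (range f2)"
    using C(1) by (auto simp: bounded_iff)
  moreover have "continuous_on UNIV f2"
    unfolding f2_def
    by (intro continuous_intros cont continuous_at_imp_continuous_on ballI) (use f1 f' in \<open>blast intro: DERIV_isCont\<close>)+
  ultimately show ?thesis
    using that f1 unfolding f1_def by blast
qed

section \<open>Supremum norm, oscillation and Taylor remainders\<close>

lemma sup_norm_upper:
  assumes "bounded (range g)"
  shows "\<bar>g x\<bar> \<le> sup_norm g"
proof -
  obtain C where "\<And>x. \<bar>g x\<bar> \<le> C"
    using assms by (auto simp: bounded_iff)
  then have "bdd_above (range (\<lambda>x. \<bar>g x\<bar>))" by (rule bdd_aboveI2)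
  then show ?thesis
    unfolding sup_norm_def by (rule cSUP_upper[OF UNIV_I])
qed

lemma oscillation_upper:
  assumes "bounded (range g)"
  shows "\<bar>g x - g y\<bar> \<le> oscillation g"
proof -
  obtain C where C: "\<And>x. \<bar>g x\<bar> \<le> C"
    using assms by (auto simp: bounded_iff)
  have "(case p of (x, y) \<Rightarrow> \<bar>g x - g y\<bar>) \<le> 2 * C" for p
    using C[of "fst p"] C[of "snd p"] by (cases p) simp
  then have "bdd_above (range (\<lambda>(x, y). \<bar>g x - g y\<bar>))" by (rule bdd_aboveI2)
  from cSUP_upper[OF _ this, of "(x, y)"] show ?thesis
    by (simp add: oscillation_def)
qed

text \<open>As \<open>F\<close> is bounded, its difference quotients over \<open>[0, n]\<close> tend to \<open>0\<close>, so \<open>F'\<close> has values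
  arbitrarily close to \<open>0\<close>.\<close>

lemma abs_derivative_le_oscillation:
  fixes F F' :: "real \<Rightarrow> real"
  assumes F': "\<And>x. (F has_real_derivative F' x) (at x)"
    and bdd: "bounded (range F)" "bounded (range F')"
  shows "\<bar>F' x\<bar> \<le> oscillation F'"
proof (rule field_le_epsilon)
  fix e :: real assume "e > 0"
  obtain C where C: "\<And>x. \<bar>F x\<bar> \<le> C"
    using bdd(1) by (auto simp: bounded_iff)
  \<comment> \<open>Chosen so that \<open>n * e = 2 * C + 1\<close> exceeds the bound
    \<open>2 * C\<close> on \<open>\<bar>F n - F 0\<bar>\<close>; the summand 1 keeps
    \<open>n\<close> positive even if \<open>C = 0\<close>.\<close>
  define n where "n = (2 * C + 1) / e"
  have "C \<ge> 0" using C[of 0] by linarith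
  then have "n > 0" using \<open>e > 0\<close> by (simp add: n_def)
  from MVT2[OF this, of F F'] F' obtain z where "F n - F 0 = n * F' z" by auto
  then have "n * \<bar>F' z\<bar> = \<bar>F n - F 0\<bar>" using \<open>n > 0\<close> by (simp add: abs_mult)
  also have "\<dots> \<le> n * e" using C[of n] C[of 0] \<open>e > 0\<close> by (simp add: n_def)
  finally have "\<bar>F' z\<bar> \<le> e" using \<open>n > 0\<close> by simp
  then show "\<bar>F' x\<bar> \<le> oscillation F' + e"
    using oscillation_upper[OF bdd(2), of x z] by linarith
qed

text \<open>Two competing estimates of one remainder: the quadratic one serves for small
  \<open>y\<close>, the linear one for large \<open>y\<close>.\<close>

lemma abs_taylor_remainder_le:
  fixes f f1 f2 :: "real \<Rightarrow> real"
  assumes f1: "\<And>x. (f has_real_derivative f1 x) (at x)"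
    and f2: "\<And>x. (f1 has_real_derivative f2 x) (at x)"
    and le: "\<And>x. \<bar>f2 x\<bar> \<le> B" "\<And>x y. \<bar>f1 x - f1 y\<bar> \<le> O1"
  shows "\<bar>f (s + y) - f s - y * f1 s\<bar> \<le> B / 2 * y\<^sup>2"
    and "\<bar>f (s + y) - f s - y * f1 s\<bar> \<le> O1 * \<bar>y\<bar>"
proof -
  show "\<bar>f (s + y) - f s - y * f1 s\<bar> \<le> B / 2 * y\<^sup>2"
  proof (cases "y = 0")
    case False
    \<comment> \<open>Taylor's theorem takes the derivatives as one indexed family and requires
      distinct points, hence the separate case \<open>y = 0\<close>. The interval from
      \<open>min s (s + y)\<close> to \<open>max s (s + y)\<close> covers both signs of
      \<open>y\<close>.\<close>
    define diff where "diff = (\<lambda>m::nat. if m = 0 then f else if m = 1 then f1 else f2)"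
    have "\<exists>t. (if s + y < s then s + y < t \<and> t < s else s < t \<and> t < s + y) \<and>
       f (s + y) = (\<Sum>m<2. diff m s / fact m * (s + y - s) ^ m) + diff 2 t / fact 2 * (s + y - s)\<^sup>2"
      by (rule Taylor[where a = "min s (s + y)" and b = "max s (s + y)"])
         (use False f1 f2 in \<open>auto simp: diff_def less_2_cases_iff\<close>)
    then obtain t where
      "f (s + y) = (\<Sum>m<2. diff m s / fact m * (s + y - s) ^ m) + diff 2 t / fact 2 * (s + y - s)\<^sup>2"
      by blast
    also have "\<dots> = f s + y * f1 s + f2 t / 2 * y\<^sup>2"
      by (simp add: diff_def lessThan_nat_numeral)
    finally have "f (s + y) - f s - y * f1 s = f2 t / 2 * y\<^sup>2"
      by linarith
    then have "\<bar>f (s + y) - f s - y * f1 s\<bar> = \<bar>f2 t\<bar> / 2 * y\<^sup>2"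
      by (simp only:) (simp add: abs_mult)
    then show ?thesis
      using le(1)[of t] by (simp add: mult_right_mono)
  qed simp
  \<comment> \<open>Subtracting the tangent slope leaves a function with derivative
    \<open>f1 t - f1 s\<close>, which \<open>O1\<close> bounds.\<close>
  have "norm ((\<lambda>t. f t - t * f1 s) (s + y) - (\<lambda>t. f t - t * f1 s) s) \<le> O1 * norm (s + y - s)"
    by (rule field_differentiable_bound[of UNIV _ "\<lambda>t. f1 t - f1 s"])
       (use le(2) in \<open>auto intro!: derivative_eq_intros has_field_derivative_at_within[OF f1]\<close>)
  then show "\<bar>f (s + y) - f s - y * f1 s\<bar> \<le> O1 * \<bar>y\<bar>"
    by (simp add: algebra_simps)
qed

lemma abs_le_affine:
  fixes f f1 :: "real \<Rightarrow> real"
  assumes "\<And>x. (f has_real_derivative f1 x) (at x)" "\<And>x. \<bar>f1 x\<bar> \<le> B"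
  shows "\<bar>f x\<bar> \<le> \<bar>f 0\<bar> + B * \<bar>x\<bar>"
proof -
  have "norm (f x - f 0) \<le> B * norm (x - 0)"
    using assms by (intro field_differentiable_bound[of UNIV f f1])
      (auto intro: has_field_derivative_at_within)
  then show ?thesis by simp
qed

section \<open>Expansion of a single summand\<close>

context prob_space
begin

lemma integrable_affine_bound:
  fixes f :: "real \<Rightarrow> real"
  assumes "integrable M Z" "f \<in> borel_measurable borel" "\<And>x. \<bar>f x\<bar> \<le> A + B * \<bar>x\<bar>"
  shows "integrable M (\<lambda>\<omega>. f (Z \<omega>))"
proof (rule Bochner_Integration.integrable_bound)
  show "integrable M (\<lambda>\<omega>. A + B * \<bar>Z \<omega>\<bar>)" using assms(1) by simp
  show "(\<lambda>\<omega>. f (Z \<omega>)) \<in> borel_measurable M"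
    using assms(1,2) by (auto intro: measurable_compose)
  show "AE \<omega> in M. norm (f (Z \<omega>)) \<le> norm (A + B * \<bar>Z \<omega>\<bar>)"
    using assms(3) by (auto intro: order.trans[OF _ abs_ge_self])
qed

text \<open>Here \<open>Y\<close> is one row entry and \<open>S\<close> the sum of the others.
  Expanding \<open>f\<close> at \<open>S\<close>, independence and \<open>expectation Y = 0\<close>
  kill the zeroth-order term and factor the first-order one. The bounds \<open>B2\<close> and
  \<open>O2\<close> on \<open>\<bar>f2\<bar>\<close> are kept apart because they are later taken as
  the supremum norm and the oscillation.\<close>

lemma stein_summand_bound:
  fixes f f1 f2 :: "real \<Rightarrow> real" and Y S :: "'a \<Rightarrow> real"
  assumes f1: "\<And>x. (f has_real_derivative f1 x) (at x)"
    and f2: "\<And>x. (f1 has_real_derivative f2 x) (at x)"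
    and B1: "\<And>x. \<bar>f1 x\<bar> \<le> B1" and B2: "\<And>x. \<bar>f2 x\<bar> \<le> B2"
    and O1: "\<And>x y. \<bar>f1 x - f1 y\<bar> \<le> O1" and O2: "\<And>x. \<bar>f2 x\<bar> \<le> O2"
    and ind: "indep_var borel Y borel S"
    and Y: "integrable M Y" "integrable M (\<lambda>\<omega>. (Y \<omega>)\<^sup>2)" "expectation Y = 0"
    and S: "integrable M S" and \<epsilon>: "\<epsilon> > 0"
  shows "integrable M (\<lambda>\<omega>. Y \<omega> * f (S \<omega> + Y \<omega>))"
    and "\<bar>expectation (\<lambda>\<omega>. Y \<omega> * f (S \<omega> + Y \<omega>)) -
          expectation (\<lambda>\<omega>. (Y \<omega>)\<^sup>2) * expectation (\<lambda>\<omega>. f1 (S \<omega> + Y \<omega>))\<bar>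
      \<le> B2 / 2 * \<epsilon> * expectation (\<lambda>\<omega>. (Y \<omega>)\<^sup>2)
        + O1 * (LINT \<omega>:{\<omega> \<in> space M. \<epsilon> \<le> \<bar>Y \<omega>\<bar>}|M. (Y \<omega>)\<^sup>2)
        + O2 * (expectation (\<lambda>\<omega>. (Y \<omega>)\<^sup>2) * expectation (\<lambda>\<omega>. \<bar>Y \<omega>\<bar>))"
proof -
  note [measurable] = borel_measurable_integrable[OF Y(1)] borel_measurable_integrable[OF S]
  have [measurable]: "f \<in> borel_measurable borel" "f1 \<in> borel_measurable borel"
    using f1 f2 by (auto intro!: borel_measurable_continuous_onI continuous_at_imp_continuous_on DERIV_isCont)
  have nonneg: "B2 \<ge> 0" "O1 \<ge> 0" using B2[of 0] O1[of 0 0] by auto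
  let ?V = "expectation (\<lambda>\<omega>. (Y \<omega>)\<^sup>2)"
  let ?A = "{\<omega> \<in> space M. \<epsilon> \<le> \<bar>Y \<omega>\<bar>}"
  define R where "R = (\<lambda>\<omega>. f (S \<omega> + Y \<omega>) - f (S \<omega>) - Y \<omega> * f1 (S \<omega>))"
  have [measurable]: "R \<in> borel_measurable M" unfolding R_def by measurable
  note remainder = abs_taylor_remainder_le[OF f1 f2 B2 O1]
  have fS: "integrable M (\<lambda>\<omega>. f (S \<omega>))"
    by (rule integrable_affine_bound[OF S _ abs_le_affine[OF f1 B1]]) simp
  have f1_int: "integrable M (\<lambda>\<omega>. f1 (Z \<omega>))" if [measurable]: "Z \<in> borel_measurable M" for Z
    by (rule integrable_const_bound[where B = B1]) (use B1 in auto)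
  have "indep_var borel ((\<lambda>y. y) \<circ> Y) borel (f \<circ> S)"
    by (rule indep_var_compose[OF ind]) auto
  then have ind0: "indep_var borel Y borel (\<lambda>\<omega>. f (S \<omega>))" by (simp add: comp_def)
  have "indep_var borel ((\<lambda>y. y\<^sup>2) \<circ> Y) borel (f1 \<circ> S)"
    by (rule indep_var_compose[OF ind]) auto
  then have ind1: "indep_var borel (\<lambda>\<omega>. (Y \<omega>)\<^sup>2) borel (\<lambda>\<omega>. f1 (S \<omega>))" by (simp add: comp_def)
  have i0: "integrable M (\<lambda>\<omega>. Y \<omega> * f (S \<omega>))" and e0: "expectation (\<lambda>\<omega>. Y \<omega> * f (S \<omega>)) = 0"
    using indep_var_integrable[OF ind0 Y(1) fS] indep_var_lebesgue_integral[OF ind0 Y(1) fS] Y(3) by auto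
  have i1: "integrable M (\<lambda>\<omega>. (Y \<omega>)\<^sup>2 * f1 (S \<omega>))"
    and e1: "expectation (\<lambda>\<omega>. (Y \<omega>)\<^sup>2 * f1 (S \<omega>)) = ?V * expectation (\<lambda>\<omega>. f1 (S \<omega>))"
    using indep_var_integrable[OF ind1 Y(2) f1_int] indep_var_lebesgue_integral[OF ind1 Y(2) f1_int] by auto
  have iA: "integrable M (\<lambda>\<omega>. indicator ?A \<omega> * (Y \<omega>)\<^sup>2)"
    using integrable_mult_indicator[OF _ Y(2), of ?A] by simp
  \<comment> \<open>On \<open>?A\<close> the linear remainder bound gives
    \<open>O1 * (Y \<omega>)\<^sup>2\<close>. Off \<open>?A\<close> the quadratic bound gives a
    cubic term, one factor of which is below \<open>\<epsilon>\<close>.\<close>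
  have R_le: "\<bar>Y \<omega> * R \<omega>\<bar> \<le> B2 / 2 * \<epsilon> * (Y \<omega>)\<^sup>2 + O1 * (indicator ?A \<omega> * (Y \<omega>)\<^sup>2)"
    if "\<omega> \<in> space M" for \<omega>
  proof (cases "\<epsilon> \<le> \<bar>Y \<omega>\<bar>")
    case True
    have "\<bar>Y \<omega>\<bar> * \<bar>R \<omega>\<bar> \<le> \<bar>Y \<omega>\<bar> * (O1 * \<bar>Y \<omega>\<bar>)"
      unfolding R_def by (intro mult_left_mono remainder) auto
    then have "\<bar>Y \<omega> * R \<omega>\<bar> \<le> O1 * (Y \<omega>)\<^sup>2"
      by (subst power2_abs[symmetric]) (simp only: abs_mult power2_eq_square ac_simps)
    moreover have "0 \<le> B2 / 2 * \<epsilon> * (Y \<omega>)\<^sup>2" using nonneg \<epsilon> by simp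
    ultimately show ?thesis using True that by simp
  next
    case False
    have "\<bar>Y \<omega>\<bar> * \<bar>R \<omega>\<bar> \<le> \<epsilon> * (B2 / 2 * (Y \<omega>)\<^sup>2)"
      unfolding R_def using False \<epsilon> by (intro mult_mono remainder) auto
    then show ?thesis using False by (simp add: abs_mult algebra_simps)
  qed
  have i2: "integrable M (\<lambda>\<omega>. Y \<omega> * R \<omega>)"
  proof (rule Bochner_Integration.integrable_bound)
    show "integrable M (\<lambda>\<omega>. B2 / 2 * \<epsilon> * (Y \<omega>)\<^sup>2 + O1 * (indicator ?A \<omega> * (Y \<omega>)\<^sup>2))"
      using Y(2) iA by auto
    show "AE \<omega> in M. norm (Y \<omega> * R \<omega>) \<le> norm (B2 / 2 * \<epsilon> * (Y \<omega>)\<^sup>2 + O1 * (indicator ?A \<omega> * (Y \<omega>)\<^sup>2))"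
      using R_le by (auto intro!: AE_I2 intro: order.trans[OF _ abs_ge_self])
  qed simp
  have eq: "(\<lambda>\<omega>. Y \<omega> * f (S \<omega> + Y \<omega>)) = (\<lambda>\<omega>. Y \<omega> * f (S \<omega>) + (Y \<omega>)\<^sup>2 * f1 (S \<omega>) + Y \<omega> * R \<omega>)"
    by (auto simp: R_def algebra_simps power2_eq_square)
  show "integrable M (\<lambda>\<omega>. Y \<omega> * f (S \<omega> + Y \<omega>))"
    unfolding eq using i0 i1 i2 by auto
  have "\<bar>expectation (\<lambda>\<omega>. Y \<omega> * R \<omega>)\<bar>
      \<le> expectation (\<lambda>\<omega>. B2 / 2 * \<epsilon> * (Y \<omega>)\<^sup>2 + O1 * (indicator ?A \<omega> * (Y \<omega>)\<^sup>2))"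
    by (rule order.trans[OF integral_abs_bound integral_mono]) (use i2 Y(2) iA R_le in auto)
  also have "\<dots> = B2 / 2 * \<epsilon> * ?V + O1 * (LINT \<omega>:?A|M. (Y \<omega>)\<^sup>2)"
    using Y(2) iA by (simp add: set_lebesgue_integral_def)
  finally have R_bound: "\<bar>expectation (\<lambda>\<omega>. Y \<omega> * R \<omega>)\<bar> \<le> \<dots>" .
  \<comment> \<open>Factoring left \<open>f1\<close> evaluated at \<open>S\<close>; moving it back
    to \<open>S + Y\<close> costs at most \<open>O2 * \<bar>Y \<omega>\<bar>\<close> pointwise, by
    the mean value theorem.\<close>
  have "\<bar>expectation (\<lambda>\<omega>. f1 (S \<omega>)) - expectation (\<lambda>\<omega>. f1 (S \<omega> + Y \<omega>))\<bar>
      = \<bar>expectation (\<lambda>\<omega>. f1 (S \<omega>) - f1 (S \<omega> + Y \<omega>))\<bar>"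
    by (subst Bochner_Integration.integral_diff) (auto intro!: f1_int)
  also have "\<dots> \<le> expectation (\<lambda>\<omega>. O2 * \<bar>Y \<omega>\<bar>)"
  proof (rule order.trans[OF integral_abs_bound integral_mono])
    fix \<omega>
    have "norm (f1 (S \<omega>) - f1 (S \<omega> + Y \<omega>)) \<le> O2 * norm (S \<omega> - (S \<omega> + Y \<omega>))"
      using O2 by (intro field_differentiable_bound[of UNIV f1 f2]) (auto intro: has_field_derivative_at_within f2)
    then show "\<bar>f1 (S \<omega>) - f1 (S \<omega> + Y \<omega>)\<bar> \<le> O2 * \<bar>Y \<omega>\<bar>" by simp
  qed (use Y(1) in \<open>auto intro!: integrable_abs Bochner_Integration.integrable_diff f1_int\<close>)
  finally have "\<bar>expectation (\<lambda>\<omega>. f1 (S \<omega>)) - expectation (\<lambda>\<omega>. f1 (S \<omega> + Y \<omega>))\<bar> \<le> O2 * expectation (\<lambda>\<omega>. \<bar>Y \<omega>\<bar>)"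
    by simp
  then have "?V * \<bar>expectation (\<lambda>\<omega>. f1 (S \<omega>)) - expectation (\<lambda>\<omega>. f1 (S \<omega> + Y \<omega>))\<bar> \<le> ?V * (O2 * expectation (\<lambda>\<omega>. \<bar>Y \<omega>\<bar>))"
    by (rule mult_left_mono) auto
  then have shift_bound: "\<bar>?V * expectation (\<lambda>\<omega>. f1 (S \<omega>)) - ?V * expectation (\<lambda>\<omega>. f1 (S \<omega> + Y \<omega>))\<bar>
      \<le> O2 * (?V * expectation (\<lambda>\<omega>. \<bar>Y \<omega>\<bar>))"
    by (simp add: abs_mult mult.left_commute flip: right_diff_distrib)
  have "expectation (\<lambda>\<omega>. Y \<omega> * f (S \<omega> + Y \<omega>))
      = ?V * expectation (\<lambda>\<omega>. f1 (S \<omega>)) + expectation (\<lambda>\<omega>. Y \<omega> * R \<omega>)"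
    unfolding eq using i0 i1 i2 e0 e1 by simp
  then show "\<bar>expectation (\<lambda>\<omega>. Y \<omega> * f (S \<omega> + Y \<omega>)) - ?V * expectation (\<lambda>\<omega>. f1 (S \<omega> + Y \<omega>))\<bar>
      \<le> B2 / 2 * \<epsilon> * ?V + O1 * (LINT \<omega>:?A|M. (Y \<omega>)\<^sup>2) + O2 * (?V * expectation (\<lambda>\<omega>. \<bar>Y \<omega>\<bar>))"
    using R_bound shift_bound by linarith
qed

end

section \<open>Stein's equation for the transform\<close>

lemma C1_differentiable_on_UNIV_iff:
  fixes f :: "real \<Rightarrow> real"
  shows "f C1_differentiable_on UNIV \<longleftrightarrow>
    (\<forall>x. (f has_real_derivative deriv f x) (at x)) \<and> continuous_on UNIV (deriv f)"
  unfolding C1_differentiable_on_def has_real_derivative_iff_has_vector_derivative[symmetric]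
  by (metis DERIV_imp_deriv UNIV_I continuous_on_cong)

lemma integrable_std_normal_affine_bound:
  fixes f :: "real \<Rightarrow> real"
  assumes [measurable]: "f \<in> borel_measurable borel" and le: "\<And>x. \<bar>f x\<bar> \<le> A + B * \<bar>x\<bar>"
  shows "integrable lborel (\<lambda>x. std_normal_density x * f x)"
proof (rule Bochner_Integration.integrable_bound)
  \<comment> \<open>The powers 0 and 1 are written out to match the absolute moments of the normal
    density.\<close>
  show "integrable lborel (\<lambda>x. A * (std_normal_density x * \<bar>x\<bar> ^ 0) + B * (std_normal_density x * \<bar>x\<bar> ^ 1))"
    by (intro Bochner_Integration.integrable_add integrable_mult_right integrable_std_normal_moment_abs)
  show "AE x in lborel. norm (std_normal_density x * f x)
      \<le> norm (A * (std_normal_density x * \<bar>x\<bar> ^ 0) + B * (std_normal_density x * \<bar>x\<bar> ^ 1))"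
  proof (rule AE_I2)
    fix x
    have "std_normal_density x * \<bar>f x\<bar> \<le> std_normal_density x * (A + B * \<bar>x\<bar>)"
      by (intro mult_left_mono le) simp
    then show "norm (std_normal_density x * f x)
      \<le> norm (A * (std_normal_density x * \<bar>x\<bar> ^ 0) + B * (std_normal_density x * \<bar>x\<bar> ^ 1))"
      by (simp add: abs_mult algebra_simps)
  qed
qed simp

text \<open>The product rule for \<open>exp (x\<^sup>2 / 2) * P x\<close> gives the equation. The
  weight cancels the exponential and leaves the primitive \<open>P\<close>, which vanishes at
  \<open>at_top\<close> because centring by the mean \<open>c\<close> makes the total integral
  zero.\<close>

lemma (in prob_space) stein_transform_solves_stein_equation:
  fixes h :: "real \<Rightarrow> real"
  assumes \<xi>: "distributed M lborel \<xi> std_normal_density"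
    and cont: "continuous_on UNIV h" and le: "\<And>x. \<bar>h x\<bar> \<le> A + B * \<bar>x\<bar>"
  defines "c \<equiv> expectation (\<lambda>\<omega>. h (\<xi> \<omega>))"
  shows "integrable M (\<lambda>\<omega>. h (\<xi> \<omega>))"
    and "(stein_transform \<xi> h has_real_derivative x * stein_transform \<xi> h x + (h x - c)) (at x)"
    and "((\<lambda>x. stein_transform \<xi> h x * exp (- x\<^sup>2 / 2)) \<longlongrightarrow> 0) at_top"
    and "((\<lambda>x. stein_transform \<xi> h x * exp (- x\<^sup>2 / 2)) \<longlongrightarrow> 0) at_bot"
proof -
  have [measurable]: "h \<in> borel_measurable borel"
    using cont by (rule borel_measurable_continuous_onI)
  show int_h: "integrable M (\<lambda>\<omega>. h (\<xi> \<omega>))"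
    using distributed_integrable[OF \<xi>, of h] integrable_std_normal_affine_bound[OF _ le] by simp
  define p where "p = (\<lambda>t. (h t - c) * exp (- t\<^sup>2 / 2))"
  define P where "P = (\<lambda>x. LBINT t:{..x}. p t)"
  \<comment> \<open>Up to normalisation \<open>p\<close> is the centred \<open>h\<close> times the
    normal density, so its integrability and integral are read off from expectations of
    \<open>h (\<xi> \<omega>)\<close>.\<close>
  have p_eq: "p = (\<lambda>t. sqrt (2 * pi) * (std_normal_density t * (h t - c)))"
    by (auto simp: p_def std_normal_density_def)
  have "integrable M (\<lambda>\<omega>. h (\<xi> \<omega>) - c)" using int_h by simp
  then have int_p: "integrable lborel p"
    unfolding p_eq using distributed_integrable[OF \<xi>, of "\<lambda>t. h t - c"] by simp
  have "(\<integral>t. std_normal_density t * (h t - c) \<partial>lborel) = 0"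
    using distributed_integral[OF \<xi>, of "\<lambda>t. h t - c"] int_h by (simp add: c_def prob_space)
  then have p0: "integral\<^sup>L lborel p = 0"
    unfolding p_eq by simp
  have cont_p: "continuous_on UNIV p"
    unfolding p_def by (intro continuous_intros cont) auto
  note P = lborel_atMost_integral[OF cont_p int_p, folded P_def, unfolded p0]
  have f_eq: "stein_transform \<xi> h = (\<lambda>x. exp (x\<^sup>2 / 2) * P x)"
    by (auto simp: stein_transform_def P_def p_def c_def)
  have "exp (x\<^sup>2 / 2) * p x = h x - c"
    by (simp add: p_def mult_exp_exp)
  then show "(stein_transform \<xi> h has_real_derivative x * stein_transform \<xi> h x + (h x - c)) (at x)"
    unfolding f_eq by (auto intro!: derivative_eq_intros P(1) simp: algebra_simps)
  have "(\<lambda>x. stein_transform \<xi> h x * exp (- x\<^sup>2 / 2)) = P"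
    unfolding f_eq by (simp add: fun_eq_iff exp_minus field_simps)
  then show "((\<lambda>x. stein_transform \<xi> h x * exp (- x\<^sup>2 / 2)) \<longlongrightarrow> 0) at_top"
    "((\<lambda>x. stein_transform \<xi> h x * exp (- x\<^sup>2 / 2)) \<longlongrightarrow> 0) at_bot"
    using P(2,3) by auto
qed

section \<open>Summation over a row and the normal approximation bound\<close>

text \<open>The single-summand bounds add up. The variances sum to 1, so they act as weights: they
  split \<open>expectation (\<lambda>\<omega>. f1 (W \<omega>))\<close> among the summands and turn
  the individual first absolute moments into their maximum.\<close>

lemma (in prob_space) stein_array_bound:
  fixes f f1 f2 :: "real \<Rightarrow> real"
  assumes X: "standard_triangular_array X" and n: "n \<ge> 1" and \<epsilon>: "\<epsilon> > 0"
    and f1: "\<And>x. (f has_real_derivative f1 x) (at x)"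
    and f2: "\<And>x. (f1 has_real_derivative f2 x) (at x)"
    and bdd: "bounded (range f1)" "bounded (range f2)"
  defines "W \<equiv> \<lambda>\<omega>. \<Sum>k=1..n. X n k \<omega>"
  shows "integrable M (\<lambda>\<omega>. W \<omega> * f (W \<omega>))"
    and "\<bar>expectation (\<lambda>\<omega>. W \<omega> * f (W \<omega>)) - expectation (\<lambda>\<omega>. f1 (W \<omega>))\<bar>
      \<le> 1 / 2 * sup_norm f2 * \<epsilon>
         + oscillation f1 *
             (\<Sum>k=1..n. LINT \<omega>:{\<omega> \<in> space M. \<epsilon> \<le> \<bar>X n k \<omega>\<bar>}|M. (X n k \<omega>)\<^sup>2)
         + oscillation f2 * (MAX k\<in>{1..n}. expectation (\<lambda>\<omega>. \<bar>X n k \<omega>\<bar>))"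
proof -
  have ind: "indep_vars (\<lambda>_. borel) (X n) {1..n}"
    and int: "\<And>k. k \<in> {1..n} \<Longrightarrow> integrable M (X n k)"
    and mean: "\<And>k. k \<in> {1..n} \<Longrightarrow> expectation (X n k) = 0"
    and int2: "\<And>k. k \<in> {1..n} \<Longrightarrow> integrable M (\<lambda>\<omega>. (X n k \<omega>)\<^sup>2)"
    and var: "(\<Sum>k=1..n. expectation (\<lambda>\<omega>. (X n k \<omega>)\<^sup>2)) = 1"
    using X n unfolding standard_triangular_array_def by auto
  define v where "v = (\<lambda>k. expectation (\<lambda>\<omega>. (X n k \<omega>)\<^sup>2))"
  define m where "m = (MAX k\<in>{1..n}. expectation (\<lambda>\<omega>. \<bar>X n k \<omega>\<bar>))"
  define T where "T = (\<lambda>k. LINT \<omega>:{\<omega> \<in> space M. \<epsilon> \<le> \<bar>X n k \<omega>\<bar>}|M. (X n k \<omega>)\<^sup>2)"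
  obtain C where C: "\<And>x. \<bar>f1 x\<bar> \<le> C" using bdd(1) by (auto simp: bounded_iff)
  \<comment> \<open>Boundedness of \<open>f1\<close> allows the oscillation of \<open>f2\<close>,
    with factor 1, to replace its supremum in the shift term.\<close>
  have O2: "\<bar>f2 x\<bar> \<le> oscillation f2" for x
    by (rule abs_derivative_le_oscillation[OF f2 bdd])
  then have O2_nonneg: "0 \<le> oscillation f2"
    by (meson abs_ge_zero order.trans)
  have summand: "integrable M (\<lambda>\<omega>. X n k \<omega> * f (W \<omega>)) \<and>
      \<bar>expectation (\<lambda>\<omega>. X n k \<omega> * f (W \<omega>)) - v k * expectation (\<lambda>\<omega>. f1 (W \<omega>))\<bar>
      \<le> sup_norm f2 / 2 * \<epsilon> * v k + oscillation f1 * T k + oscillation f2 * (v k * m)"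
    if k: "k \<in> {1..n}" for k
  proof -
    \<comment> \<open>The leave-one-out sum, independent of \<open>X n k\<close>.\<close>
    define S where "S = (\<lambda>\<omega>. \<Sum>i\<in>{1..n} - {k}. X n i \<omega>)"
    have W: "W \<omega> = S \<omega> + X n k \<omega>" for \<omega>
      using k by (simp add: W_def S_def sum.remove[of _ k])
    have "indep_vars (\<lambda>_. borel) (X n) (insert k ({1..n} - {k}))"
      using ind k by (simp add: insert_absorb)
    then have "indep_var borel (X n k) borel S"
      unfolding S_def by (intro indep_vars_sum) auto
    moreover have "integrable M S"
      unfolding S_def by (intro Bochner_Integration.integrable_sum int) auto
    ultimately have *: "integrable M (\<lambda>\<omega>. X n k \<omega> * f (W \<omega>))"
      "\<bar>expectation (\<lambda>\<omega>. X n k \<omega> * f (W \<omega>)) - v k * expectation (\<lambda>\<omega>. f1 (W \<omega>))\<bar>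
      \<le> sup_norm f2 / 2 * \<epsilon> * v k + oscillation f1 * T k
        + oscillation f2 * (v k * expectation (\<lambda>\<omega>. \<bar>X n k \<omega>\<bar>))"
      unfolding v_def T_def W
      using stein_summand_bound[OF f1 f2 C sup_norm_upper[OF bdd(2)] oscillation_upper[OF bdd(1)] O2
          _ int[OF k] int2[OF k] mean[OF k] _ \<epsilon>]
      by blast+
    have "expectation (\<lambda>\<omega>. \<bar>X n k \<omega>\<bar>) \<le> m"
      unfolding m_def using k by (intro Max_ge) auto
    moreover have "v k \<ge> 0" by (simp add: v_def)
    ultimately have "oscillation f2 * (v k * expectation (\<lambda>\<omega>. \<bar>X n k \<omega>\<bar>)) \<le> oscillation f2 * (v k * m)"
      using O2_nonneg by (intro mult_left_mono)
    with * show ?thesis by linarith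
  qed
  have W_f: "W \<omega> * f (W \<omega>) = (\<Sum>k=1..n. X n k \<omega> * f (W \<omega>))" for \<omega>
    by (simp add: W_def sum_distrib_right)
  show "integrable M (\<lambda>\<omega>. W \<omega> * f (W \<omega>))"
    unfolding W_f by (intro Bochner_Integration.integrable_sum) (use summand in blast)
  have v1: "(\<Sum>k=1..n. v k) = 1" using var by (simp add: v_def)
  have "expectation (\<lambda>\<omega>. W \<omega> * f (W \<omega>)) - (\<Sum>k=1..n. v k) * expectation (\<lambda>\<omega>. f1 (W \<omega>))
    = (\<Sum>k=1..n. expectation (\<lambda>\<omega>. X n k \<omega> * f (W \<omega>)) - v k * expectation (\<lambda>\<omega>. f1 (W \<omega>)))"
    unfolding W_f using summand
    by (subst Bochner_Integration.integral_sum) (auto simp: sum_subtractf sum_distrib_right)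
  then have "\<bar>expectation (\<lambda>\<omega>. W \<omega> * f (W \<omega>)) - expectation (\<lambda>\<omega>. f1 (W \<omega>))\<bar>
    \<le> (\<Sum>k=1..n. \<bar>expectation (\<lambda>\<omega>. X n k \<omega> * f (W \<omega>)) - v k * expectation (\<lambda>\<omega>. f1 (W \<omega>))\<bar>)"
    unfolding v1 by simp
  also have "\<dots> \<le> (\<Sum>k=1..n. sup_norm f2 / 2 * \<epsilon> * v k + oscillation f1 * T k + oscillation f2 * (v k * m))"
    by (intro sum_mono) (use summand in blast)
  also have "\<dots> = sup_norm f2 / 2 * \<epsilon> * (\<Sum>k=1..n. v k) + oscillation f1 * (\<Sum>k=1..n. T k)
      + oscillation f2 * ((\<Sum>k=1..n. v k) * m)"
    by (simp only: sum.distrib sum_distrib_left sum_distrib_right)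
  also have "\<dots> = 1 / 2 * sup_norm f2 * \<epsilon> + oscillation f1 * (\<Sum>k=1..n. T k) + oscillation f2 * m"
    unfolding v1 by simp
  finally show "\<bar>expectation (\<lambda>\<omega>. W \<omega> * f (W \<omega>)) - expectation (\<lambda>\<omega>. f1 (W \<omega>))\<bar> \<le> \<dots>"
    unfolding T_def m_def .
qed

theorem theorem3p1:
  fixes M :: "'a measure"
    and \<xi> :: "'a \<Rightarrow> real"
    and X :: "nat \<Rightarrow> nat \<Rightarrow> 'a \<Rightarrow> real"
    and h :: "real \<Rightarrow> real"
  defines "f \<equiv> prob_space.stein_transform M \<xi> h"
  assumes "prob_space M"
    and "distributed M lborel \<xi> std_normal_density"
    and "prob_space.standard_triangular_array M X"
    and "h C1_differentiable_on UNIV"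
    and "bounded (range (deriv h))"
  shows "f C1_differentiable_on UNIV \<and> deriv f C1_differentiable_on UNIV \<and>
    bounded (range (deriv f)) \<and> bounded (range (deriv (deriv f))) \<and>
    (\<forall>n\<ge>1. \<forall>\<epsilon>>0.
       \<bar>\<integral>\<omega>. h (\<xi> \<omega>) - h (\<Sum>k=1..n. X n k \<omega>) \<partial>M\<bar>
       \<le> 1 / 2 * sup_norm (deriv (deriv f)) * \<epsilon>
         + oscillation (deriv f) *
             (\<Sum>k=1..n. LINT \<omega>:{\<omega> \<in> space M. \<epsilon> \<le> \<bar>X n k \<omega>\<bar>}|M. (X n k \<omega>)\<^sup>2)
         + oscillation (deriv (deriv f)) * (MAX k\<in>{1..n}. \<integral>\<omega>. \<bar>X n k \<omega>\<bar> \<partial>M))"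
proof -
  interpret prob_space M by fact
  have h': "\<And>x. (h has_real_derivative deriv h x) (at x)" and cont_h': "continuous_on UNIV (deriv h)"
    using \<open>h C1_differentiable_on UNIV\<close> by (auto simp: C1_differentiable_on_UNIV_iff)
  obtain L where L: "\<And>x. \<bar>deriv h x\<bar> \<le> L"
    using \<open>bounded (range (deriv h))\<close> by (auto simp: bounded_iff)
  have cont_h: "continuous_on UNIV h"
    using h' by (meson DERIV_isCont continuous_at_imp_continuous_on)
  define c where "c = expectation (\<lambda>\<omega>. h (\<xi> \<omega>))"
  note h_affine = abs_le_affine[OF h' L]
  note stein = stein_transform_solves_stein_equation[OF assms(3) cont_h h_affine, folded f_def c_def]
  have "((\<lambda>x. h x - c) has_real_derivative deriv h x) (at x)" for x
    using h' by (auto intro!: derivative_eq_intros)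
  from stein_equation_C2_solution[OF stein(2) this cont_h' L stein(3,4)]
  obtain f2 where f2: "\<And>x. ((\<lambda>x. x * f x + (h x - c)) has_real_derivative f2 x) (at x)"
    and cont_f2: "continuous_on UNIV f2"
    and bdd: "bounded (range (\<lambda>x. x * f x + (h x - c)))" "bounded (range f2)"
    by blast
  \<comment> \<open>The right-hand side of Stein's equation is the derivative itself, so the
    regularity found for it transfers to \<open>deriv f\<close> and
    \<open>deriv (deriv f)\<close>.\<close>
  have deriv_f: "deriv f = (\<lambda>x. x * f x + (h x - c))"
    using stein(2) by (auto intro: DERIV_imp_deriv)
  then have deriv_f2: "deriv (deriv f) = f2"
    using f2 by (auto intro: DERIV_imp_deriv)
  note f1 = stein(2)[folded fun_cong[OF deriv_f]] and f2 = f2[folded deriv_f] and bdd = bdd[folded deriv_f]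
  have cont_f1: "continuous_on UNIV (deriv f)"
    using f2 by (meson DERIV_isCont continuous_at_imp_continuous_on)
  have "\<bar>\<integral>\<omega>. h (\<xi> \<omega>) - h (\<Sum>k=1..n. X n k \<omega>) \<partial>M\<bar>
       \<le> 1 / 2 * sup_norm f2 * \<epsilon>
         + oscillation (deriv f) *
             (\<Sum>k=1..n. LINT \<omega>:{\<omega> \<in> space M. \<epsilon> \<le> \<bar>X n k \<omega>\<bar>}|M. (X n k \<omega>)\<^sup>2)
         + oscillation f2 * (MAX k\<in>{1..n}. \<integral>\<omega>. \<bar>X n k \<omega>\<bar> \<partial>M)"
    if n: "n \<ge> 1" and \<epsilon>: "\<epsilon> > 0" for n \<epsilon>
  proof -
    define W where "W \<omega> = (\<Sum>k=1..n. X n k \<omega>)" for \<omega>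
    note bound = stein_array_bound[OF assms(4) n \<epsilon> f1 f2 bdd, folded W_def]
    have int_W: "integrable M W"
      unfolding W_def[abs_def] using assms(4) n
      by (intro Bochner_Integration.integrable_sum) (simp add: standard_triangular_array_def)
    have [measurable]: "h \<in> borel_measurable borel"
      using cont_h by (rule borel_measurable_continuous_onI)
    have int_hW: "integrable M (\<lambda>\<omega>. h (W \<omega>))"
      by (rule integrable_affine_bound[OF int_W _ h_affine]) simp
    \<comment> \<open>Stein's equation at \<open>W \<omega>\<close>, integrated; the constant
      \<open>c\<close> is the expectation of \<open>h (\<xi> \<omega>)\<close>.\<close>
    have "expectation (\<lambda>\<omega>. deriv f (W \<omega>)) = expectation (\<lambda>\<omega>. W \<omega> * f (W \<omega>) + (h (W \<omega>) - c))"
      by (simp add: deriv_f)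
    also have "\<dots> = expectation (\<lambda>\<omega>. W \<omega> * f (W \<omega>)) + (expectation (\<lambda>\<omega>. h (W \<omega>)) - c)"
      using bound(1) int_hW by (simp add: prob_space)
    finally have "expectation (\<lambda>\<omega>. h (\<xi> \<omega>) - h (W \<omega>))
        = expectation (\<lambda>\<omega>. W \<omega> * f (W \<omega>)) - expectation (\<lambda>\<omega>. deriv f (W \<omega>))"
      using stein(1) int_hW by (simp add: c_def)
    with bound(2) show ?thesis by (simp add: W_def)
  qed
  moreover have "f C1_differentiable_on UNIV" "deriv f C1_differentiable_on UNIV"
    unfolding C1_differentiable_on_UNIV_iff using f1 f2 cont_f1 cont_f2 by (auto simp: deriv_f2)
  ultimately show ?thesis
    using bdd by (simp add: deriv_f2)
qed

end
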